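(* Let $n\ge 1$ and let $A$ be an $n\times n$ alternating sign matrix. Then there is a finite sequence of ASMs $I_n=A_0,A_1,\dots,A_t=A$ such that each $A_{s+1}$ is obtained from $A_s$ by an ASM-interchange.
   Context: An alternating sign matrix (ASM) is an $n\times n$ matrix with entries in $\{0,+1,-1\}$ such that in each row and each column the nonzero entries alternate in sign, beginning and ending with $+1$. $I_n$ is the $n\times n$ identity matrix. For $1\le p<q\le n$ and $1\le k<l\le n$, $T_{p,q;k,l}$ denotes the $n\times n$ matrix with $+1$ in positions $(p,k)$ and $(q,l)$, $-1$ in positions $(p,l)$ and $(q,k)$, and $0$ elsewhere. An ASM-interchange replaces an ASM $B$ by $B+\varepsilon T_{p,q;k,l}$ for some $\varepsilon\in\{+1,-1\}$ and some such $p,q,k,l$, provided $B+\varepsilon T_{p,q;k,l}$ is again an ASM (the nonzero positions of $B$ and of $T_{p,q;k,l}$ may overlap). *)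

theory Defs
  imports "Jordan_Normal_Form.Matrix"
begin

(* Rows and columns of matrices are indexed by 0, ..., n - 1, as in the matrix library. *)

definition alternating_signs :: "int list \<Rightarrow> bool" where
  "alternating_signs xs \<longleftrightarrow>
     (let ys = filter (\<lambda>x. x \<noteq> 0) xs in
        ys \<noteq> [] \<and> hd ys = 1 \<and> last ys = 1 \<and>
        successively (\<lambda>x y. sgn y = - sgn x) ys)"

definition asm :: "nat \<Rightarrow> int mat \<Rightarrow> bool" where
  "asm n A \<longleftrightarrow>
     A \<in> carrier_mat n n \<and>
     (\<forall>i<n. \<forall>j<n. A $$ (i, j) \<in> {0, 1, -1}) \<and>
     (\<forall>i<n. alternating_signs (list_of_vec (row A i))) \<and>
     (\<forall>j<n. alternating_signs (list_of_vec (col A j)))"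

definition T_mat :: "nat \<Rightarrow> nat \<Rightarrow> nat \<Rightarrow> nat \<Rightarrow> nat \<Rightarrow> int mat" where
  "T_mat n p q k l = mat n n (\<lambda>ij.
     if ij = (p, k) \<or> ij = (q, l) then 1
     else if ij = (p, l) \<or> ij = (q, k) then -1
     else 0)"

definition asm_interchange :: "nat \<Rightarrow> int mat \<Rightarrow> int mat \<Rightarrow> bool" where
  "asm_interchange n B C \<longleftrightarrow>
     asm n B \<and> asm n C \<and>
     (\<exists>\<epsilon>\<in>{1, -1}. \<exists>p q k l. p < q \<and> q < n \<and> k < l \<and> l < n \<and>
        C = B + \<epsilon> \<cdot>\<^sub>m T_mat n p q k l)"

end

(* The corner sums c(i,j) of an ASM are the functions on {0..n} x {0..n} with c(0,j) = c(i,0) = 0,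
   c(n,j) = j, c(i,n) = i and all horizontal and vertical increments in {0,1}; the interchange on the
   adjacent rows p, p+1 and columns k, k+1 changes c at the single point (p+1, k+1). The identity
   matrix has the largest corner sums, min(i,j). If c is not min, take a point with c < min at which
   the height h = i + j - 2c is maximal. Neighbouring values of h differ by 1, and a neighbour of
   larger height would again satisfy c < min because h - |i - j| does not decrease in passing to it;
   so the point is a local maximum of h, and c can be raised by 1 there. Hence adjacent
   interchanges lead from A to the identity, and interchanges are reversible. *)
theory Submission
  imports Defs
begin

section \<open>Sign alternation in terms of partial sums\<close>

text \<open>Here \<open>s\<close> is the sum of the entries already read, and
  \<open>2 * s - 1\<close> is the last nonzero one among them: the sum is 1 after a +1 and 0 after a
  -1. Staying in {0, 1} forces the next nonzero entry to have the opposite sign. A general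
  \<open>s\<close> is needed for the induction.\<close>

lemma prefix_sums_iff_alternating:
  fixes s :: int
  assumes "s \<in> {0, 1}"
  shows "(\<forall>k\<le>length xs. s + sum_list (take k xs) \<in> {0, 1}) \<and> s + sum_list xs = 1 \<longleftrightarrow>
    set xs \<subseteq> {0, 1, -1} \<and>
    successively (\<lambda>x y. sgn y = - sgn x) ((2 * s - 1) # filter (\<lambda>x. x \<noteq> 0) xs) \<and>
    last ((2 * s - 1) # filter (\<lambda>x. x \<noteq> 0) xs) = 1"
  using assms
proof (induction xs arbitrary: s)
  case Nil
  then show ?case by auto
next
  case (Cons x xs)
  have split: "(\<forall>k\<le>length (x # xs). s + sum_list (take k (x # xs)) \<in> {0, 1}) \<longleftrightarrow>
      (\<forall>k\<le>length xs. (s + x) + sum_list (take k xs) \<in> {0, 1})"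
    using Cons.prems by (auto simp: All_less_Suc2 less_Suc_eq_le[symmetric] add.assoc)
  show ?case
  proof (cases "s + x \<in> {0, 1}")
    case True
    have "x = 0 \<or> x = 1 - 2 * s"
      using True Cons.prems by auto
    then show ?thesis
    proof
      assume "x = 0"
      then show ?thesis
        using Cons.IH[OF Cons.prems] split by simp
    next
      assume x: "x = 1 - 2 * s"
      \<comment> \<open>After reading \<open>x\<close> the last nonzero entry is \<open>x\<close>
        itself, so the induction hypothesis for \<open>s + x\<close> speaks of the filtered list
        headed by \<open>x\<close>.\<close>
      then have next_sign: "2 * (s + x) - 1 = x"
        and "x \<noteq> 0" "x \<in> {0, 1, -1}" "sgn x = - sgn (2 * s - 1)"
        using Cons.prems by auto
      then show ?thesis
        using Cons.IH[OF True, unfolded next_sign] split by (simp add: add.assoc)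
    qed
  next
    case False
    then have "\<not> (\<forall>k\<le>length xs. (s + x) + sum_list (take k xs) \<in> {0, 1})"
      by (auto intro!: exI[of _ 0])
    \<comment> \<open>Leaving {0, 1} makes both sides false: \<open>x\<close> is too large in
      absolute value or repeats the preceding sign.\<close>
    moreover have "x \<notin> {0, 1, -1} \<or> (x \<noteq> 0 \<and> sgn x \<noteq> - sgn (2 * s - 1))"
      using False Cons.prems by auto
    ultimately show ?thesis
      using split by auto
  qed
qed

lemma alternating_signs_iff_prefix_sums:
  "set xs \<subseteq> {0, 1, -1} \<and> alternating_signs xs \<longleftrightarrow>
    (\<forall>k\<le>length xs. sum_list (take k xs) \<in> {0, 1}) \<and> sum_list xs = 1"
proof -
  let ?ys = "filter (\<lambda>x. x \<noteq> 0) xs"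
  \<comment> \<open>A virtual leading -1, matching the empty sum 0, makes the first nonzero entry
    +1; requiring last entry 1 then also rules out a list of zeros.\<close>
  have "alternating_signs xs \<longleftrightarrow>
      successively (\<lambda>x y. sgn y = - sgn x) (-1 # ?ys) \<and> last (-1 # ?ys) = 1"
    if "set xs \<subseteq> {0, 1, -1}"
  proof (cases ?ys)
    case Nil
    then show ?thesis by (simp add: alternating_signs_def)
  next
    case (Cons y ys)
    then have "y \<in> {1, -1}"
      using that by (auto simp: filter_eq_Cons_iff)
    then show ?thesis
      using Cons by (auto simp: alternating_signs_def)
  qed
  then show ?thesis
    using prefix_sums_iff_alternating[of 0 xs] by auto
qed

section \<open>Corner sums and the matrices they characterise\<close>

definition corner_sum :: "int mat \<Rightarrow> nat \<Rightarrow> nat \<Rightarrow> int" where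
  "corner_sum A i j = (\<Sum>a<i. \<Sum>b<j. A $$ (a, b))"

lemma corner_sum_0 [simp]: "corner_sum A 0 j = 0" "corner_sum A i 0 = 0"
  by (simp_all add: corner_sum_def)

lemma corner_sum_Suc_row: "corner_sum A (Suc i) j = corner_sum A i j + (\<Sum>b<j. A $$ (i, b))"
  by (simp add: corner_sum_def)

lemma corner_sum_Suc_col: "corner_sum A i (Suc j) = corner_sum A i j + (\<Sum>a<i. A $$ (a, j))"
  by (simp add: corner_sum_def sum.distrib)

lemma entry_eq_corner_sum:
  "A $$ (i, j) = corner_sum A (Suc i) (Suc j) - corner_sum A i (Suc j)
     - corner_sum A (Suc i) j + corner_sum A i j"
  by (simp add: corner_sum_Suc_row)

lemma sum_list_take_vec:
  fixes v :: "int vec"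
  assumes "v \<in> carrier_vec n" "k \<le> n"
  shows "sum_list (take k (list_of_vec v)) = (\<Sum>b<k. v $ b)"
  using assms by (simp add: sum_list_sum_nth atLeast0LessThan min_absorb2 list_of_vec_index)

lemma vec_alternating_iff:
  assumes "v \<in> carrier_vec n"
  shows "(\<forall>j<n. v $ j \<in> {0, 1, -1}) \<and> alternating_signs (list_of_vec v) \<longleftrightarrow>
    (\<forall>k\<le>n. (\<Sum>b<k. v $ b) \<in> {0, 1}) \<and> (\<Sum>b<n. v $ b) = 1"
proof -
  have len: "length (list_of_vec v) = n"
    using assms by simp
  have "set (list_of_vec v) \<subseteq> {0, 1, -1} \<longleftrightarrow> (\<forall>j<n. v $ j \<in> {0, 1, -1})"
    using assms by (auto simp: set_conv_nth subset_iff list_of_vec_index; metis)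
  moreover have "sum_list (list_of_vec v) = (\<Sum>b<n. v $ b)"
    using sum_list_take_vec[OF assms order.refl] len by simp
  ultimately show ?thesis
    using alternating_signs_iff_prefix_sums[of "list_of_vec v"] sum_list_take_vec[OF assms] len
    by simp
qed

text \<open>The increment of the corner sum from \<open>i\<close> to \<open>Suc i\<close> at
  \<open>j\<close> is a partial sum of row \<open>i\<close>, and similarly for columns, so the
  increment conditions are the partial-sum criterion. The boundary values encode that full rows and
  columns sum to 1.\<close>

lemma asm_iff_corner_sum:
  "asm n A \<longleftrightarrow> A \<in> carrier_mat n n \<and>
    (\<forall>i<n. \<forall>j\<le>n. corner_sum A (Suc i) j - corner_sum A i j \<in> {0, 1}) \<and>
    (\<forall>i\<le>n. \<forall>j<n. corner_sum A i (Suc j) - corner_sum A i j \<in> {0, 1}) \<and>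
    (\<forall>i\<le>n. corner_sum A i n = int i \<and> corner_sum A n i = int i)"
proof (cases "A \<in> carrier_mat n n")
  case True
  have row: "(\<forall>j<n. A $$ (i, j) \<in> {0, 1, -1}) \<and> alternating_signs (list_of_vec (row A i)) \<longleftrightarrow>
      (\<forall>j\<le>n. (\<Sum>b<j. A $$ (i, b)) \<in> {0, 1}) \<and> (\<Sum>b<n. A $$ (i, b)) = 1" if "i < n" for i
    using vec_alternating_iff[of "row A i" n] True that by simp
  have col: "(\<forall>i<n. A $$ (i, j) \<in> {0, 1, -1}) \<and> alternating_signs (list_of_vec (col A j)) \<longleftrightarrow>
      (\<forall>i\<le>n. (\<Sum>a<i. A $$ (a, j)) \<in> {0, 1}) \<and> (\<Sum>a<n. A $$ (a, j)) = 1" if "j < n" for j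
    using vec_alternating_iff[of "col A j" n] True that by simp
  have rowsum: "(\<forall>i\<le>n. corner_sum A i n = int i) \<longleftrightarrow> (\<forall>i<n. (\<Sum>b<n. A $$ (i, b)) = 1)"
  proof
    assume L: "\<forall>i\<le>n. corner_sum A i n = int i"
    show "\<forall>i<n. (\<Sum>b<n. A $$ (i, b)) = 1"
    proof (intro allI impI)
      fix i assume "i < n"
      then show "(\<Sum>b<n. A $$ (i, b)) = 1"
        using L[rule_format, of i] L[rule_format, of "Suc i"] by (simp add: corner_sum_Suc_row)
    qed
  qed (simp add: corner_sum_def)
  have colsum: "(\<forall>j\<le>n. corner_sum A n j = int j) \<longleftrightarrow> (\<forall>j<n. (\<Sum>a<n. A $$ (a, j)) = 1)"
  proof
    assume L: "\<forall>j\<le>n. corner_sum A n j = int j"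
    show "\<forall>j<n. (\<Sum>a<n. A $$ (a, j)) = 1"
    proof (intro allI impI)
      fix j assume "j < n"
      then show "(\<Sum>a<n. A $$ (a, j)) = 1"
        using L[rule_format, of j] L[rule_format, of "Suc j"] by (simp add: corner_sum_Suc_col)
    qed
  next
    assume R: "\<forall>j<n. (\<Sum>a<n. A $$ (a, j)) = 1"
    have "corner_sum A n j = (\<Sum>b<j. \<Sum>a<n. A $$ (a, b))" for j
      unfolding corner_sum_def by (rule sum.swap)
    then show "\<forall>j\<le>n. corner_sum A n j = int j"
      using R by simp
  qed
  \<comment> \<open>The range of the entries is stated for rows and again for columns, because the
    criterion for a vector characterises alternation and range jointly.\<close>
  have "asm n A \<longleftrightarrow>
      (\<forall>i<n. (\<forall>j<n. A $$ (i, j) \<in> {0, 1, -1}) \<and> alternating_signs (list_of_vec (row A i))) \<and>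
      (\<forall>j<n. (\<forall>i<n. A $$ (i, j) \<in> {0, 1, -1}) \<and> alternating_signs (list_of_vec (col A j)))"
    using True unfolding asm_def by blast
  also have "\<dots> \<longleftrightarrow>
      (\<forall>i<n. (\<forall>j\<le>n. (\<Sum>b<j. A $$ (i, b)) \<in> {0, 1}) \<and> (\<Sum>b<n. A $$ (i, b)) = 1) \<and>
      (\<forall>j<n. (\<forall>i\<le>n. (\<Sum>a<i. A $$ (a, j)) \<in> {0, 1}) \<and> (\<Sum>a<n. A $$ (a, j)) = 1)"
    using row col by simp
  also have "\<dots> \<longleftrightarrow>
      (\<forall>i<n. \<forall>j\<le>n. corner_sum A (Suc i) j - corner_sum A i j \<in> {0, 1}) \<and>
      (\<forall>i\<le>n. \<forall>j<n. corner_sum A i (Suc j) - corner_sum A i j \<in> {0, 1}) \<and>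
      (\<forall>i\<le>n. corner_sum A i n = int i) \<and> (\<forall>i\<le>n. corner_sum A n i = int i)"
    unfolding rowsum colsum
    unfolding corner_sum_Suc_row corner_sum_Suc_col add_diff_cancel_left' by blast
  finally show ?thesis
    using True by blast
qed (simp add: asm_def)

section \<open>Effect of an adjacent interchange on corner sums\<close>

text \<open>The adjacent \<open>T_mat\<close> is the outer product of two differences of consecutive
  unit vectors, so its corner sums factor into partial sums of these, each of which is the indicator
  of a single index.\<close>

lemma corner_sum_T_mat:
  assumes "Suc p < n" "Suc k < n" "i \<le> n" "j \<le> n"
  shows "corner_sum (T_mat n p (Suc p) k (Suc k)) i j = (if i = Suc p \<and> j = Suc k then 1 else 0)"
proof -
  let ?d = "\<lambda>r m. (if m = r then 1 else 0) - (if m = Suc r then 1 else 0) :: int"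
  have d: "(\<Sum>m<N. ?d r m) = (if N = Suc r then 1 else 0)" for r N
    by (simp add: sum_subtractf)
  have "corner_sum (T_mat n p (Suc p) k (Suc k)) i j = (\<Sum>a<i. \<Sum>b<j. ?d p a * ?d k b)"
    unfolding corner_sum_def using assms
    by (intro sum.cong refl) (auto simp: T_mat_def)
  also have "\<dots> = (\<Sum>a<i. ?d p a) * (\<Sum>b<j. ?d k b)"
    by (rule sum_product[symmetric])
  finally show ?thesis
    by (simp add: d)
qed

lemma corner_sum_add_T_mat:
  assumes "A \<in> carrier_mat n n" "Suc p < n" "Suc k < n" "i \<le> n" "j \<le> n"
  shows "corner_sum (A + T_mat n p (Suc p) k (Suc k)) i j =
    corner_sum A i j + (if i = Suc p \<and> j = Suc k then 1 else 0)"
proof -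
  have "corner_sum (A + T_mat n p (Suc p) k (Suc k)) i j =
      corner_sum A i j + corner_sum (T_mat n p (Suc p) k (Suc k)) i j"
    unfolding corner_sum_def sum.distrib[symmetric] using assms
    by (intro sum.cong refl) (auto simp: T_mat_def)
  then show ?thesis
    using corner_sum_T_mat assms by simp
qed

section \<open>Maximal corner sums and raising at a point\<close>

lemma corner_sum_le_min:
  assumes "asm n A" "i \<le> n" "j \<le> n"
  shows "corner_sum A i j \<le> int (min i j)"
proof -
  have "corner_sum A i j \<le> int i"
    using assms(2)
  proof (induction i)
    case (Suc i)
    then have "corner_sum A (Suc i) j - corner_sum A i j \<in> {0, 1}"
      using assms unfolding asm_iff_corner_sum by simp
    with Suc show ?case by auto
  qed simp
  moreover have "corner_sum A i j \<le> int j"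
    using assms(3)
  proof (induction j)
    case (Suc j)
    then have "corner_sum A i (Suc j) - corner_sum A i j \<in> {0, 1}"
      using assms unfolding asm_iff_corner_sum by simp
    with Suc show ?case by auto
  qed simp
  ultimately show ?thesis by simp
qed

text \<open>Entries are mixed second differences of corner sums, and the mixed second difference of
  min is the Kronecker delta.\<close>

lemma asm_eq_one:
  assumes "asm n A" "\<And>i j. i \<le> n \<Longrightarrow> j \<le> n \<Longrightarrow> corner_sum A i j = int (min i j)"
  shows "A = 1\<^sub>m n"
proof (rule eq_matI)
  fix i j assume "i < dim_row (1\<^sub>m n :: int mat)" "j < dim_col (1\<^sub>m n :: int mat)"
  then show "A $$ (i, j) = 1\<^sub>m n $$ (i, j)"
    using assms(2) by (auto simp: entry_eq_corner_sum[of A] min_def)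
qed (use assms(1) in \<open>auto simp: asm_def\<close>)

lemma ex_raisable_point:
  assumes A: "asm n A" and "A \<noteq> 1\<^sub>m n"
  obtains p k where "Suc p < n" "Suc k < n" "asm n (A + T_mat n p (Suc p) k (Suc k))"
    "corner_sum A (Suc p) (Suc k) < int (min (Suc p) (Suc k))"
proof -
  let ?c = "corner_sum A"
  define D where "D = {(i, j). i \<le> n \<and> j \<le> n \<and> ?c i j < int (min i j)}"
  define h where "h = (\<lambda>(i, j). int i + int j - 2 * ?c i j)"
  have carrier: "A \<in> carrier_mat n n"
    and rowinc: "\<And>i j. i < n \<Longrightarrow> j \<le> n \<Longrightarrow> ?c (Suc i) j - ?c i j \<in> {0, 1}"
    and colinc: "\<And>i j. i \<le> n \<Longrightarrow> j < n \<Longrightarrow> ?c i (Suc j) - ?c i j \<in> {0, 1}"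
    and bd: "\<And>i. i \<le> n \<Longrightarrow> ?c i n = int i" "\<And>i. i \<le> n \<Longrightarrow> ?c n i = int i"
    using A unfolding asm_iff_corner_sum by blast+
  have "finite D"
    by (rule finite_subset[of _ "{..n} \<times> {..n}"]) (auto simp: D_def)
  moreover have "D \<noteq> {}"
  proof
    assume "D = {}"
    then have "?c i j = int (min i j)" if "i \<le> n" "j \<le> n" for i j
      using corner_sum_le_min[OF A that] that unfolding D_def by fastforce
    then show False
      using asm_eq_one[OF A] assms(2) by blast
  qed
  ultimately have "Max (h ` D) \<in> h ` D" and "\<And>x. x \<in> D \<Longrightarrow> h x \<le> Max (h ` D)"
    by auto
  then obtain i j where ij: "(i, j) \<in> D" and hmax: "\<And>x. x \<in> D \<Longrightarrow> h x \<le> h (i, j)"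
    by force
  have le: "i \<le> n" "j \<le> n" and lt: "?c i j < int (min i j)"
    using ij by (auto simp: D_def)
  have "i \<noteq> 0" "j \<noteq> 0"
    using lt by (metis corner_sum_0 less_irrefl min_0L min_0R of_nat_0)+
  then obtain p k where p: "i = Suc p" and k: "j = Suc k"
    by (metis not0_implies_Suc)
  \<comment> \<open>On each side of the square the boundary values already equal min, so a point of
    \<open>D\<close> is interior.\<close>
  have "i \<noteq> n" "j \<noteq> n"
    using lt bd le by auto
  then have pn: "Suc p < n" and kn: "Suc k < n"
    using le p k by auto
  have max: "h (i', j') \<le> h (i, j)" if "i' \<le> n" "j' \<le> n" "?c i' j' < int i'" "?c i' j' < int j'" for i' j'
    using hmax that by (auto simp: D_def)
  have lts: "?c i j < int i" "?c i j < int j"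
    using lt by auto
  \<comment> \<open>In each of the four directions, the other possible increment would raise
    \<open>h\<close> by 1 at the neighbour and keep it in \<open>D\<close>: going back,
    \<open>?c\<close> drops along with the index; going forward, \<open>?c\<close> stays while the
    index grows.\<close>
  have up: "?c i j = ?c p j"
    using max[of p j] rowinc[of p j] pn le lts by (auto simp: h_def p)
  have down: "?c (Suc i) j = ?c i j + 1"
    using max[of "Suc i" j] rowinc[of i j] pn le lts by (auto simp: h_def p)
  have left: "?c i j = ?c i k"
    using max[of i k] colinc[of i k] kn le lts by (auto simp: h_def k)
  have right: "?c i (Suc j) = ?c i j + 1"
    using max[of i "Suc j"] colinc[of i j] kn le lts by (auto simp: h_def k)
  let ?B = "A + T_mat n p (Suc p) k (Suc k)"
  have B: "corner_sum ?B a b = ?c a b + (if a = Suc p \<and> b = Suc k then 1 else 0)"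
    if "a \<le> n" "b \<le> n" for a b
    using corner_sum_add_T_mat[OF carrier pn kn that] .
  \<comment> \<open>Only the four increments at (\<open>Suc p\<close>, \<open>Suc k\<close>) change:
    the two entering it go from 0 to 1, the two leaving it from 1 to 0. The point is interior, so
    the boundary values persist.\<close>
  have "asm n ?B"
    unfolding asm_iff_corner_sum
  proof (intro conjI allI impI)
    show "?B \<in> carrier_mat n n"
      using carrier by (simp add: T_mat_def)
  next
    fix a b assume "a < n" "b \<le> n"
    then show "corner_sum ?B (Suc a) b - corner_sum ?B a b \<in> {0, 1}"
      using rowinc[of a b] up down by (auto simp: B p k)
  next
    fix a b assume "a \<le> n" "b < n"
    then show "corner_sum ?B a (Suc b) - corner_sum ?B a b \<in> {0, 1}"
      using colinc[of a b] left right by (auto simp: B p k)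
  next
    fix a assume "a \<le> n"
    then show "corner_sum ?B a n = int a" "corner_sum ?B n a = int a"
      using bd pn kn by (auto simp: B)
  qed
  then show ?thesis
    using that pn kn lt p k by blast
qed

section \<open>Reversibility and the chain from the identity\<close>

lemma asm_interchange_sym:
  assumes "asm_interchange n B C"
  shows "asm_interchange n C B"
proof -
  from assms obtain \<epsilon> p q k l where e: "\<epsilon> \<in> {1, -1}"
    and *: "p < q" "q < n" "k < l" "l < n" "C = B + \<epsilon> \<cdot>\<^sub>m T_mat n p q k l"
    and asms: "asm n B" "asm n C"
    unfolding asm_interchange_def by blast
  have "B = C + (- \<epsilon>) \<cdot>\<^sub>m T_mat n p q k l"
    using asms by (intro eq_matI) (auto simp: * asm_def T_mat_def)
  moreover have "- \<epsilon> \<in> {1, -1}"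
    using e by auto
  ultimately show ?thesis
    using asms * unfolding asm_interchange_def by blast
qed

text \<open>Induction on the total deficit of the corner sums from min. Raising one point lowers it
  by 1; the raised matrix is reachable by induction, and the reversed interchange leads back to
  \<open>A\<close>.\<close>

lemma asm_reachable_from_one:
  assumes "asm n A"
  shows "(asm_interchange n)\<^sup>*\<^sup>* (1\<^sub>m n) A"
  using assms
proof (induction "nat (\<Sum>(i, j)\<in>{..n} \<times> {..n}. int (min i j) - corner_sum A i j)"
    arbitrary: A rule: less_induct)
  case less
  show ?case
  proof (cases "A = 1\<^sub>m n")
    case False
    then obtain p k where pk: "Suc p < n" "Suc k < n"
      and B: "asm n (A + T_mat n p (Suc p) k (Suc k))" (is "asm n ?B")
      and lt: "corner_sum A (Suc p) (Suc k) < int (min (Suc p) (Suc k))"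
      using ex_raisable_point[OF less.prems] by blast
    have carrier: "A \<in> carrier_mat n n"
      using less.prems by (simp add: asm_def)
    note cs = corner_sum_add_T_mat[OF carrier pk]
    let ?def = "\<lambda>A (i, j). int (min i j) - corner_sum A i j"
    have "sum (?def ?B) ({..n} \<times> {..n}) < sum (?def A) ({..n} \<times> {..n})"
      by (rule sum_strict_mono_ex1) (use pk in \<open>auto simp: cs intro!: bexI[of _ "(Suc p, Suc k)"]\<close>)
    \<comment> \<open>The measure is cast by \<open>nat\<close>; nonnegativity of the new total
      makes the old one positive, so the decrease survives the cast.\<close>
    moreover have "0 \<le> sum (?def ?B) ({..n} \<times> {..n})"
      using corner_sum_le_min[OF B] by (intro sum_nonneg) auto
    ultimately have "(asm_interchange n)\<^sup>*\<^sup>* (1\<^sub>m n) ?B"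
      using less.hyps[OF _ B] by linarith
    moreover have "asm_interchange n A ?B"
      unfolding asm_interchange_def
    proof (intro conjI bexI exI)
      show "?B = A + 1 \<cdot>\<^sub>m T_mat n p (Suc p) k (Suc k)"
        by (intro eq_matI) (simp_all add: T_mat_def)
    qed (use pk B less.prems in auto)
    ultimately show ?thesis
      using asm_interchange_sym by (meson rtranclp.rtrancl_into_rtrancl)
  qed simp
qed

theorem theorem6p3:
  fixes n :: nat and A :: "int mat"
  assumes "n \<ge> 1" and "asm n A"
  shows "\<exists>(t::nat) (S :: nat \<Rightarrow> int mat).
           S 0 = 1\<^sub>m n \<and> S t = A \<and>
           (\<forall>s\<le>t. asm n (S s)) \<and>
           (\<forall>s<t. asm_interchange n (S s) (S (Suc s)))"
proof -
  obtain t S where S: "S 0 = 1\<^sub>m n" "S t = A" "\<forall>s<t. asm_interchange n (S s) (S (Suc s))"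
    using asm_reachable_from_one[OF assms(2)]
    unfolding rtranclp_power relpowp_fun_conv by blast
  \<comment> \<open>For \<open>s < t\<close> the matrix is the source of an interchange; the last
    one is \<open>A\<close> itself, which also covers \<open>t = 0\<close>.\<close>
  moreover have "asm n (S s)" if "s \<le> t" for s
    using S assms(2) that by (cases "s = t") (auto simp: asm_interchange_def)
  ultimately show ?thesis
    by blast
qed

end
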